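(* Let $a,b\in\mathbb{C}\setminus\{0,-1,-2,\ldots\}$ with $a\neq b$. Then $$\sum_{n=1}^\infty\frac{H_n}{(n+a)(n+b)}=\frac{1}{b-a}\left(\frac{H_a}{a}-\frac{H_b}{b}\right)+\frac{H_b^2-H_a^2}{2(b-a)}+\frac{\zeta(2,a+1)-\zeta(2,b+1)}{2(b-a)}.$$
   Context: For $n\in\mathbb{N}=\{1,2,\ldots\}$, $H_n=\sum_{j=1}^n \frac1j$. For $\alpha\in\mathbb{C}\setminus\{-1,-2,\ldots\}$ the shifted harmonic number is $H_\alpha=\psi(\alpha+1)+\gamma=\sum_{l=1}^\infty\left(\frac1l-\frac1{l+\alpha}\right)$, where $\psi$ is the digamma function and $\gamma$ the Euler–Mascheroni constant. $\zeta(s,c)=\sum_{n=0}^\infty (n+c)^{-s}$ is the Hurwitz zeta function. *)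

theory Defs
  imports "HOL-Analysis.Analysis"
begin

definition shifted_harm :: "complex \<Rightarrow> complex" where
  "shifted_harm \<alpha> = Digamma (\<alpha> + 1) + euler_mascheroni"

(* The Dirichlet series itself, without continuation: meaningful only for Re s > 1 and c not a
   nonpositive integer. The powers use the principal branch. *)
definition hurwitz_zeta :: "complex \<Rightarrow> complex \<Rightarrow> complex" where
  "hurwitz_zeta s c = (\<Sum>n. (of_nat n + c) powr (- s))"

lemma shifted_harm_sums:
  assumes "\<alpha> + 1 \<notin> \<int>\<^sub>\<le>\<^sub>0"
  shows "(\<lambda>l. 1 / of_nat (Suc l) - 1 / (of_nat (Suc l) + \<alpha>)) sums shifted_harm \<alpha>"
proof -
  have ne: "\<alpha> + 1 \<noteq> 0" using assms by auto
  show ?thesis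
    using summable_sums[OF summable_Digamma[OF ne]]
    by (simp add: shifted_harm_def Digamma_def inverse_eq_divide add_ac)
qed

lemma shifted_harm_of_nat: "shifted_harm (of_nat n) = harm n"
  using Digamma_of_nat[of n, where 'a = complex] by (simp add: shifted_harm_def add_ac)

end

theory Submission
  imports Defs "HOL-Real_Asymp.Real_Asymp"
begin

text \<open>
  Partial fractions reduce the theorem to the growth of \<open>S\<^sub>N(a) = (\<Sum>n=1..N. H\<^sub>n / (n + a))\<close>, since
  \<open>1 / ((n + a) (n + b)) = (1 / (n + a) - 1 / (n + b)) / (b - a)\<close>. Both \<open>S\<^sub>N(a)\<close> and \<open>S\<^sub>N(b)\<close>
  diverge, but their divergent parts coincide. Write \<open>d\<^sub>N(a) = (\<Sum>j=1..N. 1/j - 1/(j + a))\<close> for the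
  partial sums of \<open>H\<^sub>a\<close>. Then, exactly for every \<open>N\<close>,

  \<open>S\<^sub>N(a) = (H\<^sub>N\<^sup>2 / 2 - (\<Sum>j=1..N. 1 / j\<^sup>2)) + d\<^sub>N(a) / a - d\<^sub>N(a)\<^sup>2 / 2
      + (\<Sum>j=1..N. 1 / (j + a)\<^sup>2) / 2 + a E\<^sub>N(a)\<close>,

  where \<open>E\<^sub>N(a) = (\<Sum>i=1..N. (H\<^sub>N - H\<^bsub>N-i\<^esub>) / (i (i + a)))\<close>. The bracket is independent of \<open>a\<close> and
  cancels in \<open>S\<^sub>N(a) - S\<^sub>N(b)\<close>; the next three terms tend to
  \<open>H\<^sub>a / a - H\<^sub>a\<^sup>2 / 2 + \<zeta>(2, a + 1) / 2\<close>; and \<open>E\<^sub>N(a)\<close> tends to \<open>0\<close>. Subtracting the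
  same limit for \<open>b\<close> gives the formula.

  The identity (\<open>sum_harm_over_shift\<close>) comes from writing \<open>H\<^sub>n = d\<^sub>n(a) + h\<^sub>n(a)\<close> with
  \<open>h\<^sub>n(a) = (\<Sum>j=1..n. 1 / (j + a))\<close>. The sum of \<open>h\<^sub>n(a) / (n + a)\<close> is half of
  \<open>h\<^sub>N(a)\<^sup>2 + (\<Sum>j=1..N. 1 / (j + a)\<^sup>2)\<close>, and summation by parts in the sum of \<open>d\<^sub>n(a) / (n + a)\<close>
  leaves, besides products of \<open>d\<^sub>N(a)\<close> and \<open>h\<^sub>N(a)\<close>, the double sum of \<open>1 / ((i + a) j (j + a))\<close>
  over \<open>i < j \<le> N\<close> with the factor \<open>-a\<close>. This double sum is evaluated as in Euler's proof
  of \<open>\<zeta>(2,1) = \<zeta>(3)\<close>, by splitting \<open>1 / ((i + a) (j + a)) = (1 / (i + a) - 1 / (j + a)) / (j - i)\<close>;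
  truncating at \<open>N\<close> creates the error \<open>E\<^sub>N(a)\<close>. Once found, the identity can be checked by
  induction on \<open>N\<close>, where the splitting is needed only for the increment of \<open>E\<^sub>N(a)\<close>.
\<close>

section \<open>The exact partial sums\<close>

text \<open>
  Put \<open>j = i + k\<close> in the double sum of \<open>1 / (j (j - i) (i + a))\<close> over \<open>i < j\<close>. The full sum of
  \<open>1 / (k (i + k))\<close> over \<open>k\<close> is \<open>H\<^sub>i / i\<close>, and the terms with \<open>i + k > N\<close> make up
  \<open>(H\<^sub>N - H\<^bsub>N-i\<^esub>) / i\<close> of it. Multiplied by \<open>1 / (i + a)\<close> and summed over \<open>i\<close>, this is what the
  cut-off at \<open>N\<close> removes from the series of \<open>H\<^sub>i / (i (i + a))\<close> up to \<open>N\<close>.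
\<close>

definition truncation_error :: "'a :: real_normed_field \<Rightarrow> nat \<Rightarrow> 'a" where
  "truncation_error a N =
     (\<Sum>i=1..N. (harm N - harm (N - i)) / (of_nat i * (of_nat i + a)))"

lemma of_nat_plus_nonzero:
  fixes a :: "'a :: real_normed_field"
  assumes "a \<notin> \<int>\<^sub>\<le>\<^sub>0"
  shows "of_nat n + a \<noteq> 0"
proof
  assume "of_nat n + a = 0"
  then have "a = - of_nat n" by (simp add: eq_neg_iff_add_eq_0 add.commute)
  with assms show False by simp
qed

text \<open>
  For \<open>i \<le> N\<close> the \<open>i\<close>-th summand changes by \<open>-1 / ((N + 1) (N + 1 - i) (i + a))\<close>. The last
  two factors of the denominator add up to \<open>N + 1 + a\<close>, so partial fractions separate the sum
  into \<open>H\<^sub>N\<close> and the shifted harmonic sum; the new summand at \<open>i = N + 1\<close> then cancels \<open>H\<^sub>N\<close>.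
\<close>

lemma truncation_error_Suc:
  fixes a :: "'a :: real_normed_field"
  assumes "a \<notin> \<int>\<^sub>\<le>\<^sub>0"
  shows "truncation_error a (Suc N) = truncation_error a N +
     (1 / of_nat (Suc N) - (\<Sum>i=1..N. 1 / (of_nat i + a))) / (of_nat (Suc N) * (of_nat (Suc N) + a))"
proof -
  define M :: 'a where "M = of_nat (Suc N)"
  have M: "M \<noteq> 0" "M + a \<noteq> 0"
    using of_nat_plus_nonzero[OF assms, of "Suc N"] unfolding M_def by (simp_all del: of_nat_Suc)
  have harm_M: "harm (Suc N) = harm N + 1 / M"
    by (simp add: harm_Suc M_def inverse_eq_divide)
  have summand: "(harm (Suc N) - harm (Suc N - i)) / (of_nat i * (of_nat i + a)) =
      (harm N - harm (N - i)) / (of_nat i * (of_nat i + a))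
      - (1 / of_nat (Suc N - i) + 1 / (of_nat i + a)) / (M * (M + a))" if i: "i \<in> {1..N}" for i
  proof -
    define x :: 'a where "x = of_nat i"
    define y :: 'a where "y = of_nat (Suc N - i)"
    have nz: "x \<noteq> 0" "y \<noteq> 0" "x + a \<noteq> 0"
      using i of_nat_plus_nonzero[OF assms, of i] unfolding x_def y_def by (auto simp del: of_nat_Suc)
    have M_split: "M = x + y"
      using i unfolding x_def y_def M_def by (simp flip: of_nat_add)
    have "Suc N - i = Suc (N - i)" using i by auto
    then have "harm (Suc N - i) = harm (N - i) + 1 / y"
      unfolding y_def by (simp add: harm_Suc inverse_eq_divide)
    moreover have "(1 / M - 1 / y) / (x * (x + a)) = - (1 / y + 1 / (x + a)) / (M * (M + a))"
      using nz M unfolding M_split by (simp add: divide_simps)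
    ultimately show ?thesis
      unfolding harm_M x_def[symmetric] y_def[symmetric]
      by (simp add: algebra_simps add_divide_distrib diff_divide_distrib)
  qed
  have reflect: "(\<Sum>i=1..N. 1 / of_nat (Suc N - i)) = (harm N :: 'a)"
    unfolding harm_def by (subst sum.atLeastAtMost_rev) (simp add: inverse_eq_divide)
  have "truncation_error a (Suc N) =
      (\<Sum>i=1..N. (harm (Suc N) - harm (Suc N - i)) / (of_nat i * (of_nat i + a)))
      + (harm N + 1 / M) / (M * (M + a))"
    by (simp add: truncation_error_def harm_M M_def harm_expand)
  also have "(\<Sum>i=1..N. (harm (Suc N) - harm (Suc N - i)) / (of_nat i * (of_nat i + a))) =
      truncation_error a N
      - (\<Sum>i=1..N. (1 / of_nat (Suc N - i) + 1 / (of_nat i + a)) / (M * (M + a)))"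
    unfolding truncation_error_def sum_subtractf[symmetric] by (rule sum.cong[OF refl summand])
  also have "(\<Sum>i=1..N. (1 / of_nat (Suc N - i) + 1 / (of_nat i + a)) / (M * (M + a))) =
      (harm N + (\<Sum>i=1..N. 1 / (of_nat i + a))) / (M * (M + a))"
    unfolding sum_divide_distrib[symmetric] sum.distrib reflect ..
  finally show ?thesis
    unfolding M_def[symmetric] by (simp add: add_divide_distrib diff_divide_distrib)
qed

text \<open>
  In the induction step the increment of \<open>truncation_error\<close> contributes the partial sums \<open>d\<^sub>N(a)\<close>
  and \<open>H\<^sub>N\<close>; the former cancels against the increment of \<open>d\<^sub>N(a)\<^sup>2 / 2\<close>, the latter turns
  \<open>H\<^sub>N / (N + 1)\<close> into the required \<open>H\<^sub>N / (N + 1 + a)\<close>.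
\<close>

lemma sum_harm_over_shift:
  fixes a :: "'a :: real_normed_field"
  assumes "a \<notin> \<int>\<^sub>\<le>\<^sub>0"
  defines "d \<equiv> \<lambda>N. \<Sum>j=1..N. 1 / of_nat j - 1 / (of_nat j + a)"
  shows "(\<Sum>n=1..N. harm n / (of_nat n + a)) =
    (harm N)\<^sup>2 / 2 - (\<Sum>j=1..N. 1 / (of_nat j)\<^sup>2) + d N / a - (d N)\<^sup>2 / 2
    + (\<Sum>j=1..N. 1 / (of_nat j + a)\<^sup>2) / 2 + a * truncation_error a N"
proof (induction N)
  case 0
  then show ?case by (simp add: d_def truncation_error_def harm_def)
next
  case (Suc N)
  define M :: 'a where "M = of_nat (Suc N)"
  define H :: 'a where "H = harm N"
  define D where "D = d N"
  have nz: "M \<noteq> 0" "M + a \<noteq> 0" "a \<noteq> 0"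
    using of_nat_plus_nonzero[OF assms(1), of "Suc N"] of_nat_plus_nonzero[OF assms(1), of 0]
    unfolding M_def by (simp_all del: of_nat_Suc)
  have harm_M: "harm (Suc N) = H + 1 / M"
    by (simp add: harm_Suc M_def H_def inverse_eq_divide)
  have d_M: "d (Suc N) = D + (1 / M - 1 / (M + a))"
    unfolding d_def D_def M_def by simp
  have shifted: "(\<Sum>i=1..N. 1 / (of_nat i + a)) = H - D"
    unfolding H_def D_def d_def harm_def by (simp add: sum_subtractf inverse_eq_divide)
  have err: "truncation_error a (Suc N) =
      truncation_error a N + (1 / M - (H - D)) / (M * (M + a))"
    unfolding truncation_error_Suc[OF assms(1)] shifted M_def ..
  have step: "(H + 1 / M) / (M + a) =
      ((H + 1 / M)\<^sup>2 - H\<^sup>2) / 2 - 1 / M\<^sup>2 + (1 / M - 1 / (M + a)) / a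
      - ((D + (1 / M - 1 / (M + a)))\<^sup>2 - D\<^sup>2) / 2 + 1 / (M + a)\<^sup>2 / 2
      + a * ((1 / M - (H - D)) / (M * (M + a)))"
  proof -
    \<comment> \<open>With the reciprocals as unknowns, everything follows from one relation between them.\<close>
    define u v where "u = 1 / M" and "v = 1 / (M + a)"
    have uv: "u - v = a * (u * v)" using nz unfolding u_def v_def by (simp add: divide_simps)
    have quot: "(u - v) / a = u * v" using uv nz by simp
    have prod: "a * ((u - (H - D)) / (M * (M + a))) = (u - v) * (u - (H - D))"
      unfolding uv unfolding u_def v_def by simp
    have "(H + u) * v = ((H + u)\<^sup>2 - H\<^sup>2) / 2 - u\<^sup>2 + u * v
        - ((D + (u - v))\<^sup>2 - D\<^sup>2) / 2 + v\<^sup>2 / 2 + (u - v) * (u - (H - D))"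
      by (simp add: field_simps power2_eq_square)
    then show ?thesis
      unfolding quot[symmetric] prod[symmetric] unfolding u_def v_def
      by (simp add: power_one_over)
  qed
  have "(\<Sum>n=1..Suc N. harm n / (of_nat n + a)) =
      (\<Sum>n=1..N. harm n / (of_nat n + a)) + (H + 1 / M) / (M + a)"
    by (simp add: harm_M M_def)
  also have "\<dots> = (H + 1 / M)\<^sup>2 / 2 - ((\<Sum>j=1..N. 1 / (of_nat j)\<^sup>2) + 1 / M\<^sup>2)
      + (D + (1 / M - 1 / (M + a))) / a - (D + (1 / M - 1 / (M + a)))\<^sup>2 / 2
      + ((\<Sum>j=1..N. 1 / (of_nat j + a)\<^sup>2) + 1 / (M + a)\<^sup>2) / 2
      + a * (truncation_error a N + (1 / M - (H - D)) / (M * (M + a)))"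
    unfolding Suc.IH step D_def[symmetric] H_def[symmetric]
    by (simp only: add_divide_distrib diff_divide_distrib distrib_left) simp
  finally show ?case
    unfolding harm_M d_M err M_def by simp
qed

section \<open>The truncation error vanishes in the limit\<close>

text \<open>
  One constant works for all \<open>i\<close>, however close \<open>a\<close> lies to a negative integer, because
  \<open>i / (i + a) = 1 / (1 + a / i)\<close> converges and is therefore bounded.
\<close>

lemma inverse_norm_of_nat_plus_le:
  fixes a :: "'a :: real_normed_field"
  assumes "a \<notin> \<int>\<^sub>\<le>\<^sub>0"
  shows "\<exists>c>0. \<forall>i>0. 1 / norm (of_nat i + a) \<le> c / real i"
proof -
  have "(\<lambda>i. 1 / (1 + a / of_nat i)) \<longlonglongrightarrow> 1 / (1 + 0)"
    by (intro tendsto_intros lim_const_over_n) simp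
  then have "Bseq (\<lambda>i. 1 / (1 + a / of_nat i))"
    by (intro convergent_imp_Bseq convergentI)
  then obtain c where c: "c > 0" "\<And>i. norm (1 / (1 + a / of_nat i)) \<le> c"
    by (auto simp: Bseq_def)
  have "1 / norm (of_nat i + a) \<le> c / real i" if "i > 0" for i
  proof -
    have "1 / (1 + a / of_nat i) = of_nat i / (of_nat i + a)"
      using that of_nat_plus_nonzero[OF assms, of i] by (simp add: divide_simps)
    with c(2)[of i] have "real i / norm (of_nat i + a) \<le> c" by (simp add: norm_divide)
    then have "real i / norm (of_nat i + a) / real i \<le> c / real i" by (intro divide_right_mono) auto
    then show ?thesis using that by simp
  qed
  with c(1) show ?thesis by blast
qed

lemma harm_diff_le:
  assumes "i \<le> N"
  shows "harm N - harm (N - i) \<le> real i / real (Suc N - i)"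
proof -
  have split: "{1..N} = {1..N - i} \<union> {Suc (N - i)..N}" "{1..N - i} \<inter> {Suc (N - i)..N} = {}"
    using assms by auto
  have "harm N - harm (N - i) = (\<Sum>k=Suc (N - i)..N. inverse (real k))"
    unfolding harm_def split(1) by (subst sum.union_disjoint) auto
  also have "\<dots> \<le> (\<Sum>k=Suc (N - i)..N. inverse (real (Suc N - i)))"
    using assms by (intro sum_mono le_imp_inverse_le) auto
  also have "\<dots> = real i / real (Suc N - i)"
    using assms by (simp add: divide_inverse)
  finally show ?thesis .
qed

lemma sum_inverse_product_reflected:
  "(\<Sum>i=1..N. 1 / (real i * real (Suc N - i))) = 2 * harm N / real (Suc N)"
proof -
  have "(\<Sum>i=1..N. 1 / (real i * real (Suc N - i))) =
      (\<Sum>i=1..N. (inverse (real i) + inverse (real (Suc N - i))) / real (Suc N))"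
  proof (rule sum.cong[OF refl])
    fix i assume "i \<in> {1..N}"
    then have "real i > 0" "real (Suc N - i) > 0" "real (Suc N) = real i + real (Suc N - i)"
      by auto
    then show "1 / (real i * real (Suc N - i)) =
        (inverse (real i) + inverse (real (Suc N - i))) / real (Suc N)"
      by (simp only:) (simp add: divide_simps)
  qed
  also have "\<dots> = (harm N + (\<Sum>i=1..N. inverse (real (Suc N - i)))) / real (Suc N)"
    by (simp only: sum_divide_distrib[symmetric] sum.distrib harm_def)
  also have "(\<Sum>i=1..N. inverse (real (Suc N - i))) = harm N"
    unfolding harm_def by (subst sum.atLeastAtMost_rev) simp
  finally show ?thesis by simp
qed

lemma harm_over_n_tendsto_0: "(\<lambda>n. harm n / real (Suc n)) \<longlonglongrightarrow> 0"
proof -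
  have "(\<lambda>n. (harm n - ln (real n)) * (1 / real (Suc n)) + ln (real n) / real (Suc n))
      \<longlonglongrightarrow> euler_mascheroni * 0 + 0"
  proof (intro tendsto_intros euler_mascheroni_LIMSEQ)
    show "(\<lambda>n. 1 / real (Suc n)) \<longlonglongrightarrow> 0" by real_asymp
    show "(\<lambda>n. ln (real n) / real (Suc n)) \<longlonglongrightarrow> 0" by real_asymp
  qed
  then show ?thesis by (simp add: diff_divide_distrib)
qed

text \<open>
  Since \<open>H\<^sub>N - H\<^bsub>N-i\<^esub> \<le> i / (N + 1 - i)\<close> and \<open>\<bar>i + a\<bar>\<close> is at least a constant multiple of \<open>i\<close>, the
  error is dominated by the sum of \<open>1 / (i (N + 1 - i))\<close>, which is \<open>2 H\<^sub>N / (N + 1)\<close>.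
\<close>

lemma truncation_error_tendsto_0:
  fixes a :: "'a :: real_normed_field"
  assumes "a \<notin> \<int>\<^sub>\<le>\<^sub>0"
  shows "truncation_error a \<longlonglongrightarrow> 0"
proof -
  obtain c where c: "c > 0" "\<forall>i>0. 1 / norm (of_nat i + a) \<le> c / real i"
    using inverse_norm_of_nat_plus_le[OF assms] by blast
  have bound: "norm (truncation_error a N) \<le> 2 * c * (harm N / real (Suc N))" for N
  proof -
    have "norm (truncation_error a N) \<le> (\<Sum>i=1..N. c * (1 / (real i * real (Suc N - i))))"
      unfolding truncation_error_def
    proof (rule sum_norm_le)
      fix i assume i: "i \<in> {1..N}"
      have "harm N - harm (N - i) = (of_real (harm N - harm (N - i)) :: 'a)"
        by (simp add: of_real_harm)
      then have "norm (harm N - harm (N - i) :: 'a) = \<bar>harm N - harm (N - i)\<bar>"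
        by (simp only: norm_of_real)
      also have "\<dots> = harm N - harm (N - i)"
        using harm_mono[of "N - i" N, where 'a = real] by simp
      also have "\<dots> \<le> real i / real (Suc N - i)"
        using i by (intro harm_diff_le) auto
      finally have num: "norm (harm N - harm (N - i) :: 'a) \<le> real i / real (Suc N - i)" .
      have den: "1 / norm (of_nat i + a) \<le> c / real i"
        using c(2) i by simp
      have "norm ((harm N - harm (N - i)) / (of_nat i * (of_nat i + a))) =
          norm (harm N - harm (N - i) :: 'a) / real i * (1 / norm (of_nat i + a))"
        by (simp add: norm_divide norm_mult)
      also have "\<dots> \<le> real i / real (Suc N - i) / real i * (c / real i)"
        using c(1) by (intro mult_mono divide_right_mono num den) auto
      also have "\<dots> = c * (1 / (real i * real (Suc N - i)))" using i by simp
      finally show "norm ((harm N - harm (N - i)) / (of_nat i * (of_nat i + a)))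
          \<le> c * (1 / (real i * real (Suc N - i)))" .
    qed
    also have "\<dots> = 2 * c * (harm N / real (Suc N))"
      unfolding sum_distrib_left[symmetric] sum_inverse_product_reflected by simp
    finally show ?thesis .
  qed
  have "(\<lambda>N. 2 * c * (harm N / real (Suc N))) \<longlonglongrightarrow> 2 * c * 0"
    by (intro tendsto_intros harm_over_n_tendsto_0)
  then have "(\<lambda>N. 2 * c * (harm N / real (Suc N))) \<longlonglongrightarrow> 0" by simp
  with bound show ?thesis by (rule Lim_null_comparison[OF always_eventually[OF allI]])
qed

section \<open>Passage to the limit\<close>

lemma hurwitz_zeta_2_sums:
  assumes "a \<notin> \<int>\<^sub>\<le>\<^sub>0"
  shows "(\<lambda>n. 1 / (of_nat (Suc n) + a)\<^sup>2) sums hurwitz_zeta 2 (a + 1)"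
proof -
  have nz: "of_nat n + (a + 1) \<noteq> 0" for n
    using of_nat_plus_nonzero[OF assms, of "Suc n"] by (simp add: add_ac)
  have powr_eq: "(of_nat n + (a + 1)) powr (- 2) = 1 / (of_nat (Suc n) + a)\<^sup>2" for n
    using nz[of n] powr_nat'[of "of_nat n + (a + 1)" 2]
    by (simp add: powr_minus inverse_eq_divide add_ac)
  have "a + 1 \<noteq> 0" using nz[of 0] by simp
  from Polygamma_LIMSEQ[OF this, of 1]
  have "summable (\<lambda>k. inverse ((a + 1 + of_nat k) ^ Suc 1))"
    by (auto dest: sums_summable)
  then have "summable (\<lambda>n. 1 / (of_nat (Suc n) + a)\<^sup>2)"
    by (simp add: inverse_eq_divide add_ac power2_eq_square)
  then show ?thesis
    unfolding hurwitz_zeta_def powr_eq by (rule summable_sums)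
qed

lemma sums_iff_sum_from_1:
  "(\<lambda>n. f (Suc n)) sums l \<longleftrightarrow> (\<lambda>N. \<Sum>n=1..N. f n) \<longlonglongrightarrow> l"
proof -
  have "(\<Sum>n<N. f (Suc n)) = (\<Sum>n=1..N. f n)" for N
    by (simp add: sum.atLeast1_atMost_eq)
  then show ?thesis by (simp add: sums_def)
qed

text \<open>
  What is subtracted does not involve \<open>a\<close>. Hence the limit for one shift minus the limit for another
  is the limit of the difference of the unregularised sums.
\<close>

lemma sum_harm_over_shift_regularised:
  fixes a :: complex
  assumes "a \<notin> \<int>\<^sub>\<le>\<^sub>0"
  shows "(\<lambda>N. (\<Sum>n=1..N. harm n / (of_nat n + a)) - ((harm N)\<^sup>2 / 2 - (\<Sum>j=1..N. 1 / (of_nat j)\<^sup>2)))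
    \<longlonglongrightarrow> shifted_harm a / a - (shifted_harm a)\<^sup>2 / 2 + hurwitz_zeta 2 (a + 1) / 2"
proof -
  define d where "d = (\<lambda>N. \<Sum>j=1..N. 1 / of_nat j - 1 / (of_nat j + a))"
  have "a \<noteq> 0" using assms by auto
  have "a + 1 \<notin> \<int>\<^sub>\<le>\<^sub>0"
    using assms by (rule contrapos_nn) (rule plus_one_in_nonpos_Ints_imp)
  then have d: "d \<longlonglongrightarrow> shifted_harm a"
    unfolding d_def sums_iff_sum_from_1[symmetric] by (rule shifted_harm_sums)
  have zeta: "(\<lambda>N. \<Sum>j=1..N. 1 / (of_nat j + a)\<^sup>2) \<longlonglongrightarrow> hurwitz_zeta 2 (a + 1)"
    unfolding sums_iff_sum_from_1[symmetric] by (rule hurwitz_zeta_2_sums[OF assms])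
  have "(\<lambda>N. d N / a - (d N)\<^sup>2 / 2 + (\<Sum>j=1..N. 1 / (of_nat j + a)\<^sup>2) / 2 + a * truncation_error a N)
    \<longlonglongrightarrow> shifted_harm a / a - (shifted_harm a)\<^sup>2 / 2 + hurwitz_zeta 2 (a + 1) / 2 + a * 0"
    by (intro tendsto_intros d zeta truncation_error_tendsto_0 assms \<open>a \<noteq> 0\<close>) simp_all
  then show ?thesis
    unfolding sum_harm_over_shift[OF assms] d_def by (simp add: algebra_simps)
qed

theorem theorem3p1:
  fixes a b :: complex
  assumes "a \<notin> \<int>\<^sub>\<le>\<^sub>0" and "b \<notin> \<int>\<^sub>\<le>\<^sub>0" and "a \<noteq> b"
  shows "(\<lambda>n. harm (Suc n) / ((of_nat (Suc n) + a) * (of_nat (Suc n) + b))) sums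
    (1 / (b - a) * (shifted_harm a / a - shifted_harm b / b)
      + ((shifted_harm b)\<^sup>2 - (shifted_harm a)\<^sup>2) / (2 * (b - a))
      + (hurwitz_zeta 2 (a + 1) - hurwitz_zeta 2 (b + 1)) / (2 * (b - a)))"
proof -
  define L where "L = (\<lambda>x. shifted_harm x / x - (shifted_harm x)\<^sup>2 / 2 + hurwitz_zeta 2 (x + 1) / 2)"
  have diff: "b - a \<noteq> 0" using assms by simp
  have "(\<lambda>N. (\<Sum>n=1..N. harm n / (of_nat n + a)) - (\<Sum>n=1..N. harm n / (of_nat n + b)))
      \<longlonglongrightarrow> L a - L b"
    using tendsto_diff[OF sum_harm_over_shift_regularised[OF assms(1)]
        sum_harm_over_shift_regularised[OF assms(2)]] unfolding L_def by simp
  then have "(\<lambda>N. ((\<Sum>n=1..N. harm n / (of_nat n + a)) - (\<Sum>n=1..N. harm n / (of_nat n + b))) / (b - a))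
      \<longlonglongrightarrow> (L a - L b) / (b - a)"
    by (intro tendsto_divide tendsto_const diff)
  moreover have "((\<Sum>n=1..N. harm n / (of_nat n + a)) - (\<Sum>n=1..N. harm n / (of_nat n + b))) / (b - a)
      = (\<Sum>n=1..N. harm n / ((of_nat n + a) * (of_nat n + b)))" for N
    unfolding sum_subtractf[symmetric] sum_divide_distrib
  proof (rule sum.cong[OF refl])
    fix n
    show "(harm n / (of_nat n + a) - harm n / (of_nat n + b)) / (b - a)
        = harm n / ((of_nat n + a) * (of_nat n + b))"
      using diff of_nat_plus_nonzero[OF assms(1), of n] of_nat_plus_nonzero[OF assms(2), of n]
      by (simp add: divide_simps) (simp add: algebra_simps)
  qed
  moreover have "(L a - L b) / (b - a) =
      1 / (b - a) * (shifted_harm a / a - shifted_harm b / b)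
      + ((shifted_harm b)\<^sup>2 - (shifted_harm a)\<^sup>2) / (2 * (b - a))
      + (hurwitz_zeta 2 (a + 1) - hurwitz_zeta 2 (b + 1)) / (2 * (b - a))"
    unfolding L_def by (simp add: add_divide_distrib diff_divide_distrib)
  ultimately have "(\<lambda>N. \<Sum>n=1..N. harm n / ((of_nat n + a) * (of_nat n + b))) \<longlonglongrightarrow>
      1 / (b - a) * (shifted_harm a / a - shifted_harm b / b)
      + ((shifted_harm b)\<^sup>2 - (shifted_harm a)\<^sup>2) / (2 * (b - a))
      + (hurwitz_zeta 2 (a + 1) - hurwitz_zeta 2 (b + 1)) / (2 * (b - a))"
    by (simp only:)
  then show ?thesis
    by (rule iffD2[OF sums_iff_sum_from_1])
qed

end
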